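(* Let $S$ be any stopping strategy that continues with positive probability. Then the pseudo-true parameters with respect to $S$, i.e. the minimizer $(\mu_1^*(S),\mu_2^*(S),\gamma^*(S))$ of $(\mu_1,\mu_2,\gamma)\mapsto D_{KL}\big(\mathcal H^\bullet(S)\,\|\,\mathcal H(\Psi(\mu_1,\mu_2;\gamma);S)\big)$ over $\mathbb R^2\times[\gamma_l,\gamma_h]$, satisfy $\mu_1^*(S)=\mu_1^\bullet$ and $\gamma^*(S)=\gamma_n$. Moreover: (a) if $S$ is the cutoff strategy that stops exactly when $x_1\ge c$, for some $c\in\mathbb R\cup\{\infty\}$, then $\mu_2^*(S)=\mu_2^*(c)=\mu_2^\bullet+(r-\gamma_n)\cdot\big(\mu_1^\bullet-\mathbb E[X_1\mid X_1\le c]\big)$; (b) if $S$ is the cutoff strategy that stops exactly when $x_1\le c$, for some $c\in\mathbb R\cup\{-\infty\}$, then $\mu_2^*(S)=\mu_2^*(c)=\mu_2^\bullet+(r-\gamma_n)\cdot\big(\mu_1^\bullet-\mathbb E[X_1\mid X_1\ge c]\big)$. Here the expectations are with respect to the true distribution $X_1\sim\mathcal N(\mu_1^\bullet,\sigma^2)$.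
   Context: Fix $\sigma>0$, true means $\mu_1^\bullet,\mu_2^\bullet\in\mathbb R$, a true reversal parameter $r\in\mathbb R$ and an interval $[\gamma_l,\gamma_h]$ with $r,\gamma_l,\gamma_h\neq-1$. Let $\gamma_n:=\arg\min_{\gamma\in[\gamma_l,\gamma_h]}|\gamma-r|$. For $\mu_1,\mu_2,\gamma\in\mathbb R$, $\Psi(\mu_1,\mu_2;\gamma)$ is the joint law of $(X_1,X_2)$ with $X_1\sim\mathcal N(\mu_1,\sigma^2)$ and $X_2\mid(X_1=x_1)\sim\mathcal N(\mu_2-\gamma(x_1-\mu_1),\sigma^2)$. The true law is $\Psi(\mu_1^\bullet,\mu_2^\bullet;r)$. Let $\phi(\cdot\mid\mu)$ denote the density of $\mathcal N(\mu,\sigma^2)$. A (stopping) strategy is a measurable map $S:\mathbb R\to\{\text{Stop},\text{Continue}\}$ applied to the realization $x_1$ of $X_1$. It "continues with positive probability" if $S^{-1}(\text{Continue})$ has positive Lebesgue measure. The history is $(x_1,\varnothing)$ if $S(x_1)=\text{Stop}$ ($X_2$ is censored) and $(x_1,x_2)$ if $S(x_1)=\text{Continue}$. $\mathcal H(\Psi;S)$ is the law of the history when $(X_1,X_2)\sim\Psi$, and $\mathcal H^\bullet(S):=\mathcal H(\Psi(\mu_1^\bullet,\mu_2^\bullet;r);S)$. The KL divergence $D_{KL}(\mathcal H^\bullet(S)\,\|\,\mathcal H(\Psi(\mu_1,\mu_2;\gamma);S))$ is $$\int_{S^{-1}(\text{Stop})}\phi(x_1\mid\mu_1^\bullet)\ln\frac{\phi(x_1\mid\mu_1^\bullet)}{\phi(x_1\mid\mu_1)}\,dx_1+\int_{S^{-1}(\text{Continue})}\int_{-\infty}^\infty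 \phi(x_1\mid\mu_1^\bullet)\,\phi(x_2\mid\mu_2^\bullet-r(x_1-\mu_1^\bullet))\ln\frac{\phi(x_1\mid\mu_1^\bullet)\,\phi(x_2\mid\mu_2^\bullet-r(x_1-\mu_1^\bullet))}{\phi(x_1\mid\mu_1)\,\phi(x_2\mid\mu_2-\gamma(x_1-\mu_1))}\,dx_2\,dx_1 .$$ When $c=\infty$ in (a) or $c=-\infty$ in (b), the strategy never stops and the conditional expectation is $\mathbb E[X_1]=\mu_1^\bullet$. *)

theory Defs
  imports "HOL-Probability.Probability"
begin

datatype action = Stop | Continue

abbreviation normal_law :: "real \<Rightarrow> real \<Rightarrow> real measure" where
  "normal_law \<sigma> \<mu> \<equiv> density lborel (normal_density \<mu> \<sigma>)"

text \<open>Joint law of \<open>X\<^sub>1 \<sim> N(\<mu>\<^sub>1, \<sigma>\<^sup>2)\<close> and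
  \<open>X\<^sub>2 | (X\<^sub>1 = x\<^sub>1) \<sim> N(\<mu>\<^sub>2 - \<gamma> (x\<^sub>1 - \<mu>\<^sub>1), \<sigma>\<^sup>2)\<close>,
  given by its density (marginal density times conditional density).\<close>

definition \<Psi>_density :: "real \<Rightarrow> real \<Rightarrow> real \<Rightarrow> real \<Rightarrow> real \<Rightarrow> real \<Rightarrow> real" where
  "\<Psi>_density \<sigma> \<mu>1 \<mu>2 \<gamma> x1 x2 =
     normal_density \<mu>1 \<sigma> x1 * normal_density (\<mu>2 - \<gamma> * (x1 - \<mu>1)) \<sigma> x2"

definition \<Psi> :: "real \<Rightarrow> real \<Rightarrow> real \<Rightarrow> real \<Rightarrow> (real \<times> real) measure" where
  "\<Psi> \<sigma> \<mu>1 \<mu>2 \<gamma> = density (lborel \<Otimes>\<^sub>M lborel) (\<lambda>(x1, x2). \<Psi>_density \<sigma> \<mu>1 \<mu>2 \<gamma> x1 x2)"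

text \<open>A history is a pair \<open>(x\<^sub>1, None)\<close> (second draw censored) or \<open>(x\<^sub>1, Some x\<^sub>2)\<close>.
  The second component carries the disjoint-union sigma-algebra of a point and the Borel line.\<close>

definition censored_borel :: "real option measure" where
  "censored_borel = sigma UNIV (insert {None} ((\<lambda>A. Some ` A) ` sets borel))"

definition hist :: "(real \<Rightarrow> action) \<Rightarrow> real \<times> real \<Rightarrow> real \<times> real option" where
  "hist S = (\<lambda>(x1, x2). (x1, case S x1 of Stop \<Rightarrow> None | Continue \<Rightarrow> Some x2))"

definition \<H> :: "(real \<times> real) measure \<Rightarrow> (real \<Rightarrow> action) \<Rightarrow> (real \<times> real option) measure" where
  "\<H> P S = distr P (borel \<Otimes>\<^sub>M censored_borel) (hist S)"

text \<open>\<open>D_KL P Q\<close> is the divergence of \<open>P\<close> from \<open>Q\<close>, with natural logarithm and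
  expectation under \<open>P\<close>; the library constant takes the reference measure \<open>Q\<close> first.\<close>

abbreviation D_KL :: "'a measure \<Rightarrow> 'a measure \<Rightarrow> real" where
  "D_KL P Q \<equiv> KL_divergence (exp 1) Q P"

definition pseudo_true ::
  "real \<Rightarrow> real \<Rightarrow> real \<Rightarrow> real \<Rightarrow> real \<Rightarrow> real \<Rightarrow> (real \<Rightarrow> action) \<Rightarrow> real \<times> real \<times> real \<Rightarrow> bool" where
  "pseudo_true \<sigma> \<mu>1b \<mu>2b r \<gamma>l \<gamma>h S =
     is_arg_min (\<lambda>(\<mu>1, \<mu>2, \<gamma>). D_KL (\<H> (\<Psi> \<sigma> \<mu>1b \<mu>2b r) S) (\<H> (\<Psi> \<sigma> \<mu>1 \<mu>2 \<gamma>) S))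
                (\<lambda>(\<mu>1, \<mu>2, \<gamma>). \<gamma> \<in> {\<gamma>l..\<gamma>h})"

definition nearest :: "real \<Rightarrow> real \<Rightarrow> real \<Rightarrow> real" where
  "nearest \<gamma>l \<gamma>h r = arg_min (\<lambda>\<gamma>. \<bar>\<gamma> - r\<bar>) (\<lambda>\<gamma>. \<gamma> \<in> {\<gamma>l..\<gamma>h})"

text \<open>Elementary conditional expectation \<open>E[X | X \<in> A]\<close> of a real random variable with law \<open>M\<close>.\<close>

definition cond_mean :: "real measure \<Rightarrow> real set \<Rightarrow> real" where
  "cond_mean M A = (\<integral>x\<in>A. x \<partial>M) / measure M A"

text \<open>\<open>KL_divergence\<close> is a Bochner integral of the logarithm of a Radon-Nikodym derivative, so it is
  junk without absolute continuity and integrability. The lemmas below lead to \<open>D_KL_history\<close>: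
  both conditions always hold between history laws, and the divergence is the integral of
  log density ratios over the stopping and the continuation region.\<close>

lemma Psi_density_nonneg [simp]: "0 \<le> \<Psi>_density \<sigma> m1 m2 g x y"
  by (simp add: \<Psi>_density_def)

lemma measurable_Psi_density [measurable]:
  "(\<lambda>(x, y). \<Psi>_density \<sigma> m1 m2 g x y) \<in> borel_measurable (lborel \<Otimes>\<^sub>M lborel)"
  unfolding \<Psi>_density_def normal_density_def by simp

lemma nn_integral_normal_density:
  "0 < \<sigma> \<Longrightarrow> (\<integral>\<^sup>+y. ennreal (normal_density m \<sigma> y) \<partial>lborel) = 1"
  by (subst nn_integral_eq_integral)
     (auto simp: integrable_normal_density integral_normal_density)

lemma prob_space_Psi:
  assumes s: "0 < \<sigma>"
  shows "prob_space (\<Psi> \<sigma> m1 m2 g)"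
proof
  have "emeasure (\<Psi> \<sigma> m1 m2 g) (space (\<Psi> \<sigma> m1 m2 g))
      = (\<integral>\<^sup>+z. ennreal (case z of (x, y) \<Rightarrow> \<Psi>_density \<sigma> m1 m2 g x y) \<partial>(lborel \<Otimes>\<^sub>M lborel))"
    unfolding \<Psi>_def space_density
    by (subst emeasure_density[OF _ sets.top]) (auto simp: indicator_def intro!: nn_integral_cong)
  also have "\<dots> = (\<integral>\<^sup>+x. \<integral>\<^sup>+y. ennreal (\<Psi>_density \<sigma> m1 m2 g x y) \<partial>lborel \<partial>lborel)"
    using lborel.nn_integral_fst[of "\<lambda>z. ennreal (case z of (x, y) \<Rightarrow> \<Psi>_density \<sigma> m1 m2 g x y)" lborel]
    by simp
  also have "\<dots> = 1"
    using s by (simp add: \<Psi>_density_def ennreal_mult nn_integral_cmult nn_integral_normal_density)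
  finally show "emeasure (\<Psi> \<sigma> m1 m2 g) (space (\<Psi> \<sigma> m1 m2 g)) = 1" .
qed

lemma censored_generator:
  "insert {None} ((\<lambda>A. Some ` A) ` sets (borel :: real measure)) \<subseteq> Pow UNIV"
  by simp

lemma space_censored_borel [simp]: "space censored_borel = UNIV"
  unfolding censored_borel_def by (rule space_measure_of[OF censored_generator])

lemma sets_censored_borel:
  "sets censored_borel = sigma_sets UNIV (insert {None} ((\<lambda>A. Some ` A) ` sets borel))"
  unfolding censored_borel_def by (rule sets_measure_of[OF censored_generator])

lemma measurable_Some_censored [measurable]: "Some \<in> borel \<rightarrow>\<^sub>M censored_borel"
  unfolding censored_borel_def
proof (rule measurable_measure_of[OF censored_generator])
  fix A :: "real option set"
  assume "A \<in> insert {None} ((\<lambda>A. Some ` A) ` sets borel)"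
  then consider "A = {None}" | B where "B \<in> sets borel" "A = Some ` B" by blast
  then show "Some -` A \<inter> space borel \<in> sets borel"
  proof cases
    case 1
    then have "Some -` A = ({} :: real set)" by auto
    then show ?thesis by simp
  next
    case 2
    then have "Some -` A = B" by auto
    with 2 show ?thesis by simp
  qed
qed simp

lemma censored_borel_None [measurable]: "{None} \<in> sets censored_borel"
  unfolding sets_censored_borel by (rule sigma_sets.Basic) simp

lemma measurable_the_censored [measurable]: "the \<in> censored_borel \<rightarrow>\<^sub>M borel"
proof (rule measurableI)
  fix A :: "real set" assume A: "A \<in> sets borel"
  have 1: "Some ` A \<in> sets censored_borel"
    unfolding sets_censored_borel by (rule sigma_sets.Basic) (use A in simp)
  have "the -` A = Some ` A \<union> (if the None \<in> A then {None} else {})"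
  proof (rule set_eqI)
    fix z :: "real option"
    show "z \<in> the -` A \<longleftrightarrow> z \<in> Some ` A \<union> (if the None \<in> A then {None} else {})"
      by (cases z) (auto simp: image_iff)
  qed
  moreover have "Some ` A \<union> (if the None \<in> A then {None} else {}) \<in> sets censored_borel"
    using 1 censored_borel_None by (simp add: sets.Un)
  ultimately show "the -` A \<inter> space censored_borel \<in> sets censored_borel"
    by simp
qed simp

lemma measurable_hist:
  assumes S: "S \<in> borel \<rightarrow>\<^sub>M count_space UNIV"
  shows "hist S \<in> (lborel \<Otimes>\<^sub>M lborel) \<rightarrow>\<^sub>M (borel \<Otimes>\<^sub>M censored_borel)"
proof -
  note [measurable] = S
  have eq: "hist S = (\<lambda>z. (fst z, if S (fst z) = Stop then None else Some (snd z)))"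
    by (simp add: hist_def fun_eq_iff split: action.split)
  have [measurable]: "(\<lambda>z. None) \<in> (lborel \<Otimes>\<^sub>M lborel) \<rightarrow>\<^sub>M censored_borel" by simp
  show ?thesis unfolding eq by measurable
qed

definition hist_ratio ::
  "real \<Rightarrow> real \<Rightarrow> real \<Rightarrow> real \<Rightarrow> real \<Rightarrow> real \<Rightarrow> real \<Rightarrow> real \<times> real option \<Rightarrow> real" where
  "hist_ratio \<sigma> a1 a2 r m1 m2 g z = (case snd z of
       None \<Rightarrow> normal_density a1 \<sigma> (fst z) / normal_density m1 \<sigma> (fst z)
     | Some y \<Rightarrow> \<Psi>_density \<sigma> a1 a2 r (fst z) y / \<Psi>_density \<sigma> m1 m2 g (fst z) y)"

lemma hist_ratio_nonneg [simp]: "0 \<le> hist_ratio \<sigma> a1 a2 r m1 m2 g z"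
  by (simp add: hist_ratio_def split: option.split)

lemma measurable_hist_ratio [measurable]:
  "hist_ratio \<sigma> a1 a2 r m1 m2 g \<in> borel_measurable (borel \<Otimes>\<^sub>M censored_borel)"
proof -
  have eq: "hist_ratio \<sigma> a1 a2 r m1 m2 g = (\<lambda>z. if snd z \<in> {None}
      then normal_density a1 \<sigma> (fst z) / normal_density m1 \<sigma> (fst z)
      else \<Psi>_density \<sigma> a1 a2 r (fst z) (the (snd z)) / \<Psi>_density \<sigma> m1 m2 g (fst z) (the (snd z)))"
    by (simp add: hist_ratio_def fun_eq_iff split: option.split)
  show ?thesis unfolding eq \<Psi>_density_def normal_density_def by measurable
qed

lemma history_law_density:
  assumes s: "0 < \<sigma>" and S: "S \<in> borel \<rightarrow>\<^sub>M count_space UNIV"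
  shows "\<H> (\<Psi> \<sigma> a1 a2 r) S
       = density (\<H> (\<Psi> \<sigma> m1 m2 g) S) (hist_ratio \<sigma> a1 a2 r m1 m2 g)"
proof (rule measure_eqI)
  let ?f = "hist_ratio \<sigma> a1 a2 r m1 m2 g"
  show "sets (\<H> (\<Psi> \<sigma> a1 a2 r) S) = sets (density (\<H> (\<Psi> \<sigma> m1 m2 g) S) ?f)"
    by (simp add: \<H>_def)
  fix A assume "A \<in> sets (\<H> (\<Psi> \<sigma> a1 a2 r) S)"
  then have A [measurable]: "A \<in> sets (borel \<Otimes>\<^sub>M censored_borel)" by (simp add: \<H>_def)
  note [measurable] = measurable_hist[OF S]
  let ?p = "\<lambda>z. case z of (x, y) \<Rightarrow> \<Psi>_density \<sigma> a1 a2 r x y"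
  let ?q = "\<lambda>z. case z of (x, y) \<Rightarrow> \<Psi>_density \<sigma> m1 m2 g x y"
  let ?L = "lborel \<Otimes>\<^sub>M lborel :: (real \<times> real) measure"
  have h1: "hist S \<in> \<Psi> \<sigma> b1 b2 b3 \<rightarrow>\<^sub>M (borel \<Otimes>\<^sub>M censored_borel)" for b1 b2 b3
    unfolding \<Psi>_def by simp
  have pos: "normal_density b \<sigma> x > 0" for b x by (rule normal_density_pos[OF s])
  have inner: "(\<integral>\<^sup>+y. ennreal (\<Psi>_density \<sigma> a1 a2 r x y) * indicator A (hist S (x, y)) \<partial>lborel)
     = (\<integral>\<^sup>+y. ennreal (\<Psi>_density \<sigma> m1 m2 g x y) * (ennreal (?f (hist S (x, y))) * indicator A (hist S (x, y))) \<partial>lborel)"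
    for x
  proof (cases "S x")
    case Stop
    have "(\<integral>\<^sup>+y. ennreal (\<Psi>_density \<sigma> a1 a2 r x y) * indicator A (hist S (x, y)) \<partial>lborel)
        = ennreal (normal_density a1 \<sigma> x) * indicator A (x, None)"
      using s Stop by (simp add: hist_def \<Psi>_density_def ennreal_mult nn_integral_cmult
          nn_integral_multc nn_integral_normal_density)
    moreover have "(\<integral>\<^sup>+y. ennreal (\<Psi>_density \<sigma> m1 m2 g x y) * (ennreal (?f (hist S (x, y))) * indicator A (hist S (x, y))) \<partial>lborel)
        = ennreal (normal_density m1 \<sigma> x) * (ennreal (normal_density a1 \<sigma> x / normal_density m1 \<sigma> x) * indicator A (x, None))"
      using s Stop by (simp add: hist_def hist_ratio_def \<Psi>_density_def ennreal_mult nn_integral_cmult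
          nn_integral_multc nn_integral_normal_density)
    moreover have "ennreal (normal_density m1 \<sigma> x) * ennreal (normal_density a1 \<sigma> x / normal_density m1 \<sigma> x)
        = ennreal (normal_density a1 \<sigma> x)"
      using pos[of m1 x] by (simp add: ennreal_mult[symmetric])
    ultimately show ?thesis by (simp add: mult.assoc[symmetric])
  next
    case Continue
    have "ennreal (\<Psi>_density \<sigma> m1 m2 g x y) * ennreal (\<Psi>_density \<sigma> a1 a2 r x y / \<Psi>_density \<sigma> m1 m2 g x y)
        = ennreal (\<Psi>_density \<sigma> a1 a2 r x y)" for y
    proof -
      have "\<Psi>_density \<sigma> m1 m2 g x y \<noteq> 0"
        using pos[of m1 x] pos[of "m2 - g * (x - m1)" y] by (simp add: \<Psi>_density_def)
      then show ?thesis by (simp add: ennreal_mult[symmetric])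
    qed
    then show ?thesis
      using Continue by (simp add: hist_def hist_ratio_def mult.assoc[symmetric])
  qed
  have "emeasure (\<H> (\<Psi> \<sigma> a1 a2 r) S) A = (\<integral>\<^sup>+z. indicator A z \<partial>\<H> (\<Psi> \<sigma> a1 a2 r) S)"
    by (simp add: \<H>_def)
  also have "\<dots> = (\<integral>\<^sup>+z. indicator A (hist S z) \<partial>\<Psi> \<sigma> a1 a2 r)"
    unfolding \<H>_def by (rule nn_integral_distr[OF h1]) simp
  also have "\<dots> = (\<integral>\<^sup>+z. ennreal (?p z) * indicator A (hist S z) \<partial>?L)"
    unfolding \<Psi>_def by (rule nn_integral_density) simp_all
  also have "\<dots> = (\<integral>\<^sup>+x. \<integral>\<^sup>+y. ennreal (\<Psi>_density \<sigma> a1 a2 r x y) * indicator A (hist S (x, y)) \<partial>lborel \<partial>lborel)"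
    using lborel.nn_integral_fst[of "\<lambda>z. ennreal (?p z) * indicator A (hist S z)" lborel] by simp
  also have "\<dots> = (\<integral>\<^sup>+x. \<integral>\<^sup>+y. ennreal (\<Psi>_density \<sigma> m1 m2 g x y) * (ennreal (?f (hist S (x, y))) * indicator A (hist S (x, y))) \<partial>lborel \<partial>lborel)"
    by (simp only: inner)
  also have "\<dots> = (\<integral>\<^sup>+z. ennreal (?q z) * (ennreal (?f (hist S z)) * indicator A (hist S z)) \<partial>?L)"
    using lborel.nn_integral_fst[of "\<lambda>z. ennreal (?q z) * (ennreal (?f (hist S z)) * indicator A (hist S z))" lborel] by simp
  also have "\<dots> = (\<integral>\<^sup>+z. ennreal (?f (hist S z)) * indicator A (hist S z) \<partial>\<Psi> \<sigma> m1 m2 g)"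
    unfolding \<Psi>_def by (rule nn_integral_density[symmetric]) simp_all
  also have "\<dots> = (\<integral>\<^sup>+z. ennreal (?f z) * indicator A z \<partial>\<H> (\<Psi> \<sigma> m1 m2 g) S)"
    unfolding \<H>_def by (rule nn_integral_distr[OF h1, symmetric]) simp
  also have "\<dots> = emeasure (density (\<H> (\<Psi> \<sigma> m1 m2 g) S) ?f) A"
    by (rule emeasure_density[symmetric]) (simp_all add: \<H>_def)
  finally show "emeasure (\<H> (\<Psi> \<sigma> a1 a2 r) S) A = emeasure (density (\<H> (\<Psi> \<sigma> m1 m2 g) S) ?f) A" .
qed

lemma ln_normal_density_ratio:
  assumes "0 < \<sigma>"
  shows "ln (normal_density a \<sigma> x / normal_density m \<sigma> x) = ((x - m)\<^sup>2 - (x - a)\<^sup>2) / (2 * \<sigma>\<^sup>2)"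
proof -
  have "normal_density a \<sigma> x / normal_density m \<sigma> x = exp (((x - m)\<^sup>2 - (x - a)\<^sup>2) / (2 * \<sigma>\<^sup>2))"
    using assms by (simp add: normal_density_def exp_diff[symmetric] diff_divide_distrib)
  then show ?thesis by simp
qed

lemma ln_Psi_density_ratio:
  assumes s: "0 < \<sigma>"
  shows "ln (\<Psi>_density \<sigma> a1 a2 r x y / \<Psi>_density \<sigma> m1 m2 g x y)
    = ((x - m1)\<^sup>2 - (x - a1)\<^sup>2) / (2 * \<sigma>\<^sup>2)
    + ((y - (m2 - g * (x - m1)))\<^sup>2 - (y - (a2 - r * (x - a1)))\<^sup>2) / (2 * \<sigma>\<^sup>2)"
proof -
  have pos: "normal_density b \<sigma> x > 0" for b x by (rule normal_density_pos[OF s])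
  let ?u = "normal_density a1 \<sigma> x / normal_density m1 \<sigma> x"
  let ?v = "normal_density (a2 - r * (x - a1)) \<sigma> y / normal_density (m2 - g * (x - m1)) \<sigma> y"
  have "\<Psi>_density \<sigma> a1 a2 r x y / \<Psi>_density \<sigma> m1 m2 g x y = ?u * ?v"
    by (simp add: \<Psi>_density_def)
  then have "ln (\<Psi>_density \<sigma> a1 a2 r x y / \<Psi>_density \<sigma> m1 m2 g x y) = ln ?u + ln ?v"
    using pos by (simp only: ln_mult_pos divide_pos_pos)
  then show ?thesis by (simp only: ln_normal_density_ratio[OF s])
qed

lemma normal_second_moment:
  assumes "0 < \<sigma>"
  shows "has_bochner_integral lborel (\<lambda>x. normal_density m \<sigma> x * (c + d * (x - m)\<^sup>2)) (c + d * \<sigma>\<^sup>2)"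
proof -
  have 1: "has_bochner_integral lborel (\<lambda>x. normal_density m \<sigma> x * (x - m)\<^sup>2) (\<sigma>\<^sup>2)"
    using normal_moment_even[of \<sigma> m 1] assms by (simp add: power2_eq_square)
  have 2: "has_bochner_integral lborel (normal_density m \<sigma>) 1"
    using assms by (simp add: has_bochner_integral_iff integrable_normal_density integral_normal_density)
  have "has_bochner_integral lborel
      (\<lambda>x. c * normal_density m \<sigma> x + d * (normal_density m \<sigma> x * (x - m)\<^sup>2)) (c * 1 + d * \<sigma>\<^sup>2)"
    by (intro has_bochner_integral_add has_bochner_integral_mult_right 1 2)
  then show ?thesis by (simp add: algebra_simps)
qed

lemma integrable_quadratic_bound:
  assumes s: "0 < \<sigma>"
  shows "integrable (lborel \<Otimes>\<^sub>M lborel) (\<lambda>(x, y). normal_density a \<sigma> x *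
      normal_density (p - q * (x - b)) \<sigma> y * (1 + (x - a)\<^sup>2 + (y - (p - q * (x - b)))\<^sup>2))"
    (is "integrable _ (\<lambda>(x, y). ?F x y)")
proof (rule lborel_pair.Fubini_integrable)
  show "(\<lambda>(x, y). ?F x y) \<in> borel_measurable (lborel \<Otimes>\<^sub>M lborel)"
    unfolding normal_density_def by simp
  have inner: "has_bochner_integral lborel (\<lambda>y. ?F x y)
      (normal_density a \<sigma> x * ((1 + (x - a)\<^sup>2) + 1 * \<sigma>\<^sup>2))" for x
  proof -
    have "has_bochner_integral lborel (\<lambda>y. normal_density a \<sigma> x * (normal_density (p - q * (x - b)) \<sigma> y *
        ((1 + (x - a)\<^sup>2) + 1 * (y - (p - q * (x - b)))\<^sup>2))) (normal_density a \<sigma> x * ((1 + (x - a)\<^sup>2) + 1 * \<sigma>\<^sup>2))"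
      by (intro has_bochner_integral_mult_right normal_second_moment[OF s])
    then show ?thesis by (simp add: mult.assoc)
  qed
  then show "AE x in lborel. integrable lborel (\<lambda>y. case (x, y) of (x, y) \<Rightarrow> ?F x y)"
    by (auto simp: has_bochner_integral_iff)
  have nn: "norm (?F x y) = ?F x y" for x y by simp
  have "(\<integral>y. norm (?F x y) \<partial>lborel) = normal_density a \<sigma> x * ((1 + \<sigma>\<^sup>2) + 1 * (x - a)\<^sup>2)" for x
    unfolding nn using inner[of x] by (simp add: has_bochner_integral_iff algebra_simps)
  moreover have "integrable lborel (\<lambda>x. normal_density a \<sigma> x * ((1 + \<sigma>\<^sup>2) + 1 * (x - a)\<^sup>2))"
    using normal_second_moment[OF s] has_bochner_integral_iff by blast
  ultimately show "integrable lborel (\<lambda>x. \<integral>y. norm (case (x, y) of (x, y) \<Rightarrow> ?F x y) \<partial>lborel)"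
    by simp
qed

lemma square_diff_bound: "\<bar>(v + w)\<^sup>2 - v\<^sup>2\<bar> \<le> v\<^sup>2 + 2 * w\<^sup>2" for v w :: real
proof -
  have "0 \<le> (v + w)\<^sup>2" "0 \<le> (v - w)\<^sup>2" "0 \<le> w\<^sup>2" by simp_all
  then show ?thesis unfolding power2_sum power2_diff by linarith
qed

theorem D_KL_history:
  assumes s: "0 < \<sigma>" and S: "S \<in> borel \<rightarrow>\<^sub>M count_space UNIV"
  shows "D_KL (\<H> (\<Psi> \<sigma> a1 a2 r) S) (\<H> (\<Psi> \<sigma> m1 m2 g) S) =
    (\<integral>x\<in>S -` {Stop}. normal_density a1 \<sigma> x *
        ln (normal_density a1 \<sigma> x / normal_density m1 \<sigma> x) \<partial>lborel) +
    (\<integral>x\<in>S -` {Continue}. (\<integral>y. \<Psi>_density \<sigma> a1 a2 r x y *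
        ln (\<Psi>_density \<sigma> a1 a2 r x y / \<Psi>_density \<sigma> m1 m2 g x y) \<partial>lborel) \<partial>lborel)"
proof -
  note [measurable] = measurable_hist[OF S] S
  let ?f = "hist_ratio \<sigma> a1 a2 r m1 m2 g"
  let ?q = "\<lambda>z. case z of (x, y) \<Rightarrow> \<Psi>_density \<sigma> m1 m2 g x y"
  let ?L = "lborel \<Otimes>\<^sub>M lborel :: (real \<times> real) measure"
  have pos: "normal_density b \<sigma> x > 0" for b x by (rule normal_density_pos[OF s])
  have h1: "hist S \<in> \<Psi> \<sigma> b1 b2 b3 \<rightarrow>\<^sub>M (borel \<Otimes>\<^sub>M censored_borel)" for b1 b2 b3
    unfolding \<Psi>_def by simp
  interpret H: prob_space "\<H> (\<Psi> \<sigma> m1 m2 g) S"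
    unfolding \<H>_def by (rule prob_space.prob_space_distr[OF prob_space_Psi[OF s] h1])
  define G where "G = (\<lambda>z. ?q z * (?f (hist S z) * ln (?f (hist S z))))"
  have G_meas [measurable]: "G \<in> borel_measurable ?L" unfolding G_def by measurable
  have "D_KL (\<H> (\<Psi> \<sigma> a1 a2 r) S) (\<H> (\<Psi> \<sigma> m1 m2 g) S)
      = KL_divergence (exp 1) (\<H> (\<Psi> \<sigma> m1 m2 g) S) (density (\<H> (\<Psi> \<sigma> m1 m2 g) S) ?f)"
    by (simp only: history_law_density[OF s S, of a1 a2 r m1 m2 g])
  also have "\<dots> = (\<integral>z. ?f z * log (exp 1) (?f z) \<partial>\<H> (\<Psi> \<sigma> m1 m2 g) S)"
    by (rule H.KL_density) (simp_all add: \<H>_def)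
  also have "\<dots> = (\<integral>z. ?f z * ln (?f z) \<partial>\<H> (\<Psi> \<sigma> m1 m2 g) S)"
    by (simp add: log_def)
  also have "\<dots> = (\<integral>z. ?f (hist S z) * ln (?f (hist S z)) \<partial>\<Psi> \<sigma> m1 m2 g)"
    unfolding \<H>_def by (rule integral_distr[OF h1]) simp
  also have "\<dots> = (\<integral>z. G z \<partial>?L)"
    unfolding \<Psi>_def G_def by (subst integral_density) (simp_all add: split_beta')
  finally have KL: "D_KL (\<H> (\<Psi> \<sigma> a1 a2 r) S) (\<H> (\<Psi> \<sigma> m1 m2 g) S) = (\<integral>z. G z \<partial>?L)" .
  let ?d = "\<lambda>x. ((x - m1)\<^sup>2 - (x - a1)\<^sup>2) / (2 * \<sigma>\<^sup>2)"
  let ?e = "\<lambda>x y. ((y - (m2 - g * (x - m1)))\<^sup>2 - (y - (a2 - r * (x - a1)))\<^sup>2) / (2 * \<sigma>\<^sup>2)"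
  have G_Stop: "G (x, y) = normal_density a1 \<sigma> x * normal_density (m2 - g * (x - m1)) \<sigma> y * ?d x"
    if "S x = Stop" for x y
    using that pos[of m1 x] ln_normal_density_ratio[OF s, of a1 x m1]
    by (simp add: G_def hist_def hist_ratio_def \<Psi>_density_def)
  have G_Cont': "G (x, y) = \<Psi>_density \<sigma> a1 a2 r x y *
        ln (\<Psi>_density \<sigma> a1 a2 r x y / \<Psi>_density \<sigma> m1 m2 g x y)" if "S x = Continue" for x y
  proof -
    have "\<Psi>_density \<sigma> m1 m2 g x y \<noteq> 0"
      using pos[of m1 x] pos[of "m2 - g * (x - m1)" y] by (simp add: \<Psi>_density_def)
    then show ?thesis using that by (simp add: G_def hist_def hist_ratio_def)
  qed
  have G_Cont: "G (x, y) = normal_density a1 \<sigma> x * normal_density (a2 - r * (x - a1)) \<sigma> y * (?d x + ?e x y)"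
    if "S x = Continue" for x y
    unfolding G_Cont'[OF that] ln_Psi_density_ratio[OF s] by (simp add: \<Psi>_density_def)
  let ?B = "\<lambda>p q b (x, y). normal_density a1 \<sigma> x * normal_density (p - q * (x - b)) \<sigma> y *
      (1 + (x - a1)\<^sup>2 + (y - (p - q * (x - b)))\<^sup>2)"
  define d where "d = a1 - m1"
  define w0 where "w0 = a2 - m2 + g * d"
  define w1 where "w1 = g - r"
  define K where "K = (1 + 2 * d\<^sup>2 + 4 * w0\<^sup>2 + 4 * w1\<^sup>2) / (2 * \<sigma>\<^sup>2)"
  have d_bound: "\<bar>(x - m1)\<^sup>2 - (x - a1)\<^sup>2\<bar> \<le> (1 + 2 * d\<^sup>2) * (1 + (x - a1)\<^sup>2)" for x
  proof -
    have "\<bar>(x - m1)\<^sup>2 - (x - a1)\<^sup>2\<bar> \<le> (x - a1)\<^sup>2 + 2 * d\<^sup>2"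
      using square_diff_bound[of "x - a1" d] by (simp add: d_def)
    also have "\<dots> \<le> (1 + 2 * d\<^sup>2) * (1 + (x - a1)\<^sup>2)" by (simp add: algebra_simps)
    finally show ?thesis .
  qed
  have e_bound: "\<bar>(y - (m2 - g * (x - m1)))\<^sup>2 - (y - (a2 - r * (x - a1)))\<^sup>2\<bar>
      \<le> (y - (a2 - r * (x - a1)))\<^sup>2 + 4 * w0\<^sup>2 + 4 * w1\<^sup>2 * (x - a1)\<^sup>2" for x y
  proof -
    let ?v = "y - (a2 - r * (x - a1))" and ?w = "w0 + w1 * (x - a1)"
    have "y - (m2 - g * (x - m1)) = ?v + ?w"
      by (simp add: w0_def w1_def d_def algebra_simps)
    then have "\<bar>(y - (m2 - g * (x - m1)))\<^sup>2 - ?v\<^sup>2\<bar> \<le> ?v\<^sup>2 + 2 * ?w\<^sup>2"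
      using square_diff_bound[of ?v ?w] by (simp only:)
    moreover have "?w\<^sup>2 \<le> 2 * w0\<^sup>2 + 2 * w1\<^sup>2 * (x - a1)\<^sup>2"
    proof -
      have "0 \<le> (w0 - w1 * (x - a1))\<^sup>2" by simp
      then show ?thesis
        unfolding power2_sum power2_diff power_mult_distrib by linarith
    qed
    ultimately show ?thesis by linarith
  qed
  have bound: "\<bar>N\<bar> / (2 * \<sigma>\<^sup>2) \<le> K * (1 + u + v)"
    if "\<bar>N\<bar> \<le> (1 + 2 * d\<^sup>2 + 4 * w0\<^sup>2 + 4 * w1\<^sup>2) * (1 + u + v)" for N u v
    unfolding K_def using divide_right_mono[OF that, of "2 * \<sigma>\<^sup>2"] by simp
  have K0: "0 \<le> K" by (simp add: K_def)
  have int: "integrable ?L G"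
  proof (rule Bochner_Integration.integrable_bound)
    show "integrable ?L (\<lambda>z. K * (?B m2 g m1 z + ?B a2 r a1 z))"
      by (intro integrable_mult_right Bochner_Integration.integrable_add integrable_quadratic_bound[OF s])
    have "norm (G (x, y)) \<le> norm (K * (?B m2 g m1 (x, y) + ?B a2 r a1 (x, y)))" for x y
    proof -
      have B0: "0 \<le> ?B p q b (x, y)" for p q b by simp
      have "norm (G (x, y)) \<le> K * ?B m2 g m1 (x, y) \<or> norm (G (x, y)) \<le> K * ?B a2 r a1 (x, y)"
      proof (cases "S x")
        case Stop
        have "\<bar>?d x\<bar> \<le> K * (1 + (x - a1)\<^sup>2 + (y - (m2 - g * (x - m1)))\<^sup>2)"
        proof -
          have "\<bar>(x - m1)\<^sup>2 - (x - a1)\<^sup>2\<bar> \<le> (1 + 2 * d\<^sup>2) * (1 + (x - a1)\<^sup>2)" by (rule d_bound)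
          also have "\<dots> \<le> (1 + 2 * d\<^sup>2 + 4 * w0\<^sup>2 + 4 * w1\<^sup>2) * (1 + (x - a1)\<^sup>2 + (y - (m2 - g * (x - m1)))\<^sup>2)"
            by (intro mult_mono) simp_all
          finally show ?thesis using bound by simp
        qed
        from mult_left_mono[OF this, of "normal_density a1 \<sigma> x * normal_density (m2 - g * (x - m1)) \<sigma> y"]
        have "norm (G (x, y)) \<le> K * ?B m2 g m1 (x, y)"
          unfolding G_Stop[OF Stop] by (simp add: abs_mult mult.assoc mult.left_commute)
        then show ?thesis ..
      next
        case Continue
        have "\<bar>?d x + ?e x y\<bar> \<le> K * (1 + (x - a1)\<^sup>2 + (y - (a2 - r * (x - a1)))\<^sup>2)"
        proof -
          let ?N = "((x - m1)\<^sup>2 - (x - a1)\<^sup>2) + ((y - (m2 - g * (x - m1)))\<^sup>2 - (y - (a2 - r * (x - a1)))\<^sup>2)"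
          have "\<bar>?N\<bar> \<le> (1 + 2 * d\<^sup>2) * (1 + (x - a1)\<^sup>2) +
              ((y - (a2 - r * (x - a1)))\<^sup>2 + 4 * w0\<^sup>2 + 4 * w1\<^sup>2 * (x - a1)\<^sup>2)"
            by (rule order_trans[OF abs_triangle_ineq add_mono[OF d_bound e_bound]])
          also have "\<dots> \<le> (1 + 2 * d\<^sup>2 + 4 * w0\<^sup>2 + 4 * w1\<^sup>2) * (1 + (x - a1)\<^sup>2 + (y - (a2 - r * (x - a1)))\<^sup>2)"
            (is "?l \<le> ?r")
          proof -
            let ?v = "(y - (a2 - r * (x - a1)))\<^sup>2" and ?u = "(x - a1)\<^sup>2"
            have "?r - ?l = 4 * w1\<^sup>2 + 4 * w0\<^sup>2 * ?u + (2 * d\<^sup>2 + 4 * w0\<^sup>2 + 4 * w1\<^sup>2) * ?v"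
              by (simp add: distrib_left distrib_right)
            moreover have "0 \<le> 4 * w1\<^sup>2 + 4 * w0\<^sup>2 * ?u + (2 * d\<^sup>2 + 4 * w0\<^sup>2 + 4 * w1\<^sup>2) * ?v"
              by (intro add_nonneg_nonneg mult_nonneg_nonneg) simp_all
            ultimately show ?thesis by linarith
          qed
          finally show ?thesis using bound[of ?N] by (simp add: add_divide_distrib[symmetric])
        qed
        from mult_left_mono[OF this, of "normal_density a1 \<sigma> x * normal_density (a2 - r * (x - a1)) \<sigma> y"]
        have "norm (G (x, y)) \<le> K * ?B a2 r a1 (x, y)"
          unfolding G_Cont[OF Continue] by (simp add: abs_mult mult.assoc mult.left_commute)
        then show ?thesis ..
      qed
      moreover have "0 \<le> K * ?B m2 g m1 (x, y)" "0 \<le> K * ?B a2 r a1 (x, y)"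
        using K0 B0 by (intro mult_nonneg_nonneg; simp)+
      ultimately have "norm (G (x, y)) \<le> K * (?B m2 g m1 (x, y) + ?B a2 r a1 (x, y))"
        unfolding distrib_left by linarith
      then show ?thesis unfolding real_norm_def by linarith
    qed
    then show "AE z in ?L. norm (G z) \<le> norm (K * (?B m2 g m1 z + ?B a2 r a1 z))"
      by (intro AE_I2) (simp only: split_paired_all)
  qed simp
  let ?I = "\<lambda>x. \<integral>y. G (x, y) \<partial>lborel"
  have int': "integrable ?L (\<lambda>(x, y). G (x, y))" using int by simp
  have intI: "integrable lborel ?I" by (rule lborel_pair.integrable_fst[OF int'])
  have sets [measurable]: "S -` {Stop} \<in> sets lborel" "S -` {Continue} \<in> sets lborel"
    using measurable_sets[OF S, of "{Stop}"] measurable_sets[OF S, of "{Continue}"] by simp_all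
  have "(\<integral>z. G z \<partial>?L) = (\<integral>x. ?I x \<partial>lborel)"
    using lborel_pair.integral_fst[OF int'] by simp
  also have "\<dots> = (\<integral>x. indicator (S -` {Stop}) x *\<^sub>R ?I x + indicator (S -` {Continue}) x *\<^sub>R ?I x \<partial>lborel)"
  proof (rule Bochner_Integration.integral_cong[OF refl])
    fix x show "?I x = indicator (S -` {Stop}) x *\<^sub>R ?I x + indicator (S -` {Continue}) x *\<^sub>R ?I x"
      by (cases "S x") simp_all
  qed
  also have "\<dots> = (\<integral>x\<in>S -` {Stop}. ?I x \<partial>lborel) + (\<integral>x\<in>S -` {Continue}. ?I x \<partial>lborel)"
    unfolding set_lebesgue_integral_def
    by (intro Bochner_Integration.integral_add integrable_mult_indicator sets intI)
  also have "(\<integral>x\<in>S -` {Stop}. ?I x \<partial>lborel) = (\<integral>x\<in>S -` {Stop}. normal_density a1 \<sigma> x *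
        ln (normal_density a1 \<sigma> x / normal_density m1 \<sigma> x) \<partial>lborel)"
  proof (rule set_lebesgue_integral_cong[OF sets(1)], intro allI impI)
    fix x assume "x \<in> S -` {Stop}"
    then show "?I x = normal_density a1 \<sigma> x * ln (normal_density a1 \<sigma> x / normal_density m1 \<sigma> x)"
      using s by (simp add: G_Stop ln_normal_density_ratio integral_normal_density)
  qed
  also have "(\<integral>x\<in>S -` {Continue}. ?I x \<partial>lborel) = (\<integral>x\<in>S -` {Continue}. (\<integral>y. \<Psi>_density \<sigma> a1 a2 r x y *
        ln (\<Psi>_density \<sigma> a1 a2 r x y / \<Psi>_density \<sigma> m1 m2 g x y) \<partial>lborel) \<partial>lborel)"
    by (rule set_lebesgue_integral_cong[OF sets(2)]) (simp add: G_Cont')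
  finally show ?thesis using KL by simp
qed

end

theory Submission
  imports Defs
begin

text \<open>Since the noise variances agree, \<open>2 \<sigma>\<^sup>2\<close> times the divergence is
  \<open>(\<mu>\<^sub>1 - \<mu>\<^sub>1\<^sup>\<bullet>)\<^sup>2\<close> plus the integral over the continuation region, against the true law of
  \<open>X\<^sub>1\<close>, of the squared difference of the two conditional means of \<open>X\<^sub>2\<close>. This difference is affine
  in \<open>x\<^sub>1\<close> with slope \<open>\<gamma> - r\<close>, so splitting off its mean gives
  \<open>(\<mu>\<^sub>1 - \<mu>\<^sub>1\<^sup>\<bullet>)\<^sup>2 + p (\<dots>)\<^sup>2 + V (\<gamma> - r)\<^sup>2\<close> with \<open>p\<close> and \<open>V\<close> positive. The middle square can be
  made to vanish through \<open>\<mu>\<^sub>2\<close>, whatever \<open>\<mu>\<^sub>1\<close> and \<open>\<gamma>\<close> are.\<close>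

text \<open>\<open>nearest\<close> picks some minimizer by choice. The projection of
  \<open>r\<close> onto the interval is the only minimizer of the distance, so the choice is forced,
  and later comparisons reduce to case splits on \<open>max\<close> and \<open>min\<close>.\<close>

lemma nearest_eq_clamp:
  assumes "\<gamma>l \<le> \<gamma>h"
  shows "nearest \<gamma>l \<gamma>h r = max \<gamma>l (min r \<gamma>h)"
  unfolding nearest_def arg_min_def
proof (rule some_equality)
  show "is_arg_min (\<lambda>\<gamma>. \<bar>\<gamma> - r\<bar>) (\<lambda>\<gamma>. \<gamma> \<in> {\<gamma>l..\<gamma>h}) (max \<gamma>l (min r \<gamma>h))"
    using assms by (auto simp: is_arg_min_linorder max_def min_def)
  fix g assume "is_arg_min (\<lambda>\<gamma>. \<bar>\<gamma> - r\<bar>) (\<lambda>\<gamma>. \<gamma> \<in> {\<gamma>l..\<gamma>h}) g"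
  then have "g \<in> {\<gamma>l..\<gamma>h}" "\<bar>g - r\<bar> \<le> \<bar>max \<gamma>l (min r \<gamma>h) - r\<bar>"
    using assms by (auto simp: is_arg_min_linorder)
  then show "g = max \<gamma>l (min r \<gamma>h)"
    using assms by (auto simp: max_def min_def split: if_splits)
qed

section \<open>Gaussian integrals and the divergence of history laws\<close>

lemma normal_density_central_moments:
  assumes "0 < \<sigma>"
  shows "integrable lborel (\<lambda>x. normal_density m \<sigma> x * (x - m))"
    and "integrable lborel (\<lambda>x. normal_density m \<sigma> x * (x - m)\<^sup>2)"
    and "(\<integral>x. normal_density m \<sigma> x * (x - m) \<partial>lborel) = 0"
  using assms normal_moment_odd[of \<sigma> m 0] normal_second_moment[of \<sigma> m 0 1]
  by (auto simp: has_bochner_integral_iff)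

text \<open>The difference of squares is affine in \<open>y - a\<close>, so only the total mass and
  the vanishing first central moment enter. For \<open>c = 0\<close> the value is the divergence of
  two normal laws with common variance; \<open>c\<close> lets the log ratio of the first draw pass
  through the integral over the second.\<close>

lemma integral_normal_density_square_diff:
  assumes "0 < \<sigma>"
  shows "(\<integral>y. normal_density a \<sigma> y * (c + ((y - m)\<^sup>2 - (y - a)\<^sup>2) / (2 * \<sigma>\<^sup>2)) \<partial>lborel)
    = c + (a - m)\<^sup>2 / (2 * \<sigma>\<^sup>2)"
    and "integrable lborel (\<lambda>y. normal_density a \<sigma> y * (c + ((y - m)\<^sup>2 - (y - a)\<^sup>2) / (2 * \<sigma>\<^sup>2)))"
proof -
  have eq: "normal_density a \<sigma> y * (c + ((y - m)\<^sup>2 - (y - a)\<^sup>2) / (2 * \<sigma>\<^sup>2))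
    = (c + (a - m)\<^sup>2 / (2 * \<sigma>\<^sup>2)) * normal_density a \<sigma> y
      + (a - m) / \<sigma>\<^sup>2 * (normal_density a \<sigma> y * (y - a))" for y
    using assms by (simp add: field_simps power2_eq_square)
  show "(\<integral>y. normal_density a \<sigma> y * (c + ((y - m)\<^sup>2 - (y - a)\<^sup>2) / (2 * \<sigma>\<^sup>2)) \<partial>lborel)
      = c + (a - m)\<^sup>2 / (2 * \<sigma>\<^sup>2)"
    unfolding eq using assms normal_density_central_moments[of \<sigma> a]
    by (simp add: integrable_normal_density integral_normal_density)
  show "integrable lborel (\<lambda>y. normal_density a \<sigma> y * (c + ((y - m)\<^sup>2 - (y - a)\<^sup>2) / (2 * \<sigma>\<^sup>2)))"
    unfolding eq using assms normal_density_central_moments[of \<sigma> a]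
    by (intro Bochner_Integration.integrable_add integrable_mult_right)
      (simp_all add: integrable_normal_density)
qed

lemma set_integrable_normal_density_square:
  assumes "0 < \<sigma>" and "A \<in> sets borel"
  shows "set_integrable lborel A (\<lambda>x. normal_density m \<sigma> x * (e + w * (x - m))\<^sup>2)"
proof -
  have eq: "normal_density m \<sigma> x * (e + w * (x - m))\<^sup>2 = e\<^sup>2 * normal_density m \<sigma> x
    + 2 * e * w * (normal_density m \<sigma> x * (x - m)) + w\<^sup>2 * (normal_density m \<sigma> x * (x - m)\<^sup>2)" for x
    by (simp add: algebra_simps power2_eq_square)
  have "integrable lborel (\<lambda>x. normal_density m \<sigma> x * (e + w * (x - m))\<^sup>2)"
    unfolding eq using assms normal_density_central_moments[of \<sigma> m]
    by (intro Bochner_Integration.integrable_add integrable_mult_right)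
      (simp_all add: integrable_normal_density)
  then show ?thesis
    unfolding set_integrable_def using assms by (intro integrable_mult_indicator) simp_all
qed

text \<open>The log ratio of the first draw occurs on both regions, which together exhaust the line,
  so its contribution does not depend on \<open>S\<close>. The second draw contributes the
  divergence between its two conditional laws, and only where it is observed.\<close>

lemma D_KL_history_normal:
  assumes s: "0 < \<sigma>" and S: "S \<in> borel \<rightarrow>\<^sub>M count_space UNIV"
  shows "D_KL (\<H> (\<Psi> \<sigma> a1 a2 r) S) (\<H> (\<Psi> \<sigma> m1 m2 g) S) = ((a1 - m1)\<^sup>2 +
    (\<integral>x\<in>S -` {Continue}. normal_density a1 \<sigma> x *
        (a2 - m2 + g * (a1 - m1) + (g - r) * (x - a1))\<^sup>2 \<partial>lborel)) / (2 * \<sigma>\<^sup>2)"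
proof -
  have sets: "S -` {Stop} \<in> sets borel" "S -` {Continue} \<in> sets borel"
    using measurable_sets[OF S, of "{Stop}"] measurable_sets[OF S, of "{Continue}"] by simp_all
  let ?d = "\<lambda>x. normal_density a1 \<sigma> x * (((x - m1)\<^sup>2 - (x - a1)\<^sup>2) / (2 * \<sigma>\<^sup>2))"
  let ?q = "\<lambda>x. normal_density a1 \<sigma> x * (a2 - m2 + g * (a1 - m1) + (g - r) * (x - a1))\<^sup>2"
  have int_d: "integrable lborel ?d"
    using integral_normal_density_square_diff(2)[OF s, of a1 0 m1] by simp
  have set_int: "set_integrable lborel (S -` {B}) ?d" for B
    unfolding set_integrable_def using sets
    by (cases B) (intro integrable_mult_indicator int_d; simp)+
  have inner: "(\<integral>y. \<Psi>_density \<sigma> a1 a2 r x y *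
      ln (\<Psi>_density \<sigma> a1 a2 r x y / \<Psi>_density \<sigma> m1 m2 g x y) \<partial>lborel) = ?d x + ?q x / (2 * \<sigma>\<^sup>2)" for x
  proof -
    \<comment> \<open>The gap between the conditional means of the second draw, re-expanded around
      the true mean \<open>a1\<close>.\<close>
    have eq: "a2 - r * (x - a1) - (m2 - g * (x - m1)) = a2 - m2 + g * (a1 - m1) + (g - r) * (x - a1)"
      by (simp add: algebra_simps)
    show ?thesis
      unfolding ln_Psi_density_ratio[OF s] unfolding \<Psi>_density_def mult.assoc
      by (subst integral_mult_right_zero, subst integral_normal_density_square_diff(1)[OF s])
        (simp only: eq, simp add: distrib_left)
  qed
  have "(\<integral>x\<in>S -` {Stop}. ?d x \<partial>lborel) + (\<integral>x\<in>S -` {Continue}. ?d x \<partial>lborel) = (\<integral>x. ?d x \<partial>lborel)"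
  proof -
    have "S -` {Stop} \<union> S -` {Continue} = UNIV"
      using action.exhaust by auto
    moreover have "(\<integral>x\<in>S -` {Stop} \<union> S -` {Continue}. ?d x \<partial>lborel)
        = (\<integral>x\<in>S -` {Stop}. ?d x \<partial>lborel) + (\<integral>x\<in>S -` {Continue}. ?d x \<partial>lborel)"
      by (rule set_integral_Un) (use set_int in auto)
    ultimately show ?thesis
      by (simp add: set_lebesgue_integral_def)
  qed
  also have "\<dots> = (a1 - m1)\<^sup>2 / (2 * \<sigma>\<^sup>2)"
    using integral_normal_density_square_diff(1)[OF s, of a1 0 m1] by simp
  finally have d: "(\<integral>x\<in>S -` {Stop}. ?d x \<partial>lborel) + (\<integral>x\<in>S -` {Continue}. ?d x \<partial>lborel)
    = (a1 - m1)\<^sup>2 / (2 * \<sigma>\<^sup>2)" .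
  have "(\<integral>x\<in>S -` {Continue}. ?d x + ?q x / (2 * \<sigma>\<^sup>2) \<partial>lborel)
      = (\<integral>x\<in>S -` {Continue}. ?d x \<partial>lborel) + (\<integral>x\<in>S -` {Continue}. ?q x / (2 * \<sigma>\<^sup>2) \<partial>lborel)"
    using set_integrable_normal_density_square[OF s sets(2)]
    by (intro set_integral_add set_int set_integrable_divide) auto
  then show ?thesis
    using d unfolding D_KL_history[OF s S] ln_normal_density_ratio[OF s] inner
    by (simp add: add_divide_distrib)
qed

section \<open>Second moments of a normal law on a set of positive measure\<close>

lemma set_integral_pos:
  fixes f :: "'a \<Rightarrow> real"
  assumes "set_integrable M A f" and A: "A \<in> sets M" and "emeasure M A > 0"
    and pos: "AE x in M. x \<in> A \<longrightarrow> f x > 0"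
  shows "(\<integral>x\<in>A. f x \<partial>M) > 0"
proof -
  have int: "integrable M (\<lambda>x. indicator A x *\<^sub>R f x)"
    using assms(1) by (simp add: set_integrable_def)
  have nn: "AE x in M. 0 \<le> indicator A x *\<^sub>R f x"
    using pos by eventually_elim (auto simp: indicator_def)
  \<comment> \<open>A zero integral would force the nonnegative integrand to vanish almost
    everywhere; as \<open>f\<close> is positive almost everywhere on \<open>A\<close>, this would
    make \<open>A\<close> a null set.\<close>
  have "integral\<^sup>L M (\<lambda>x. indicator A x *\<^sub>R f x) \<noteq> 0"
  proof
    assume "integral\<^sup>L M (\<lambda>x. indicator A x *\<^sub>R f x) = 0"
    then have "AE x in M. indicator A x *\<^sub>R f x = 0"
      using integral_nonneg_eq_0_iff_AE[OF int nn] by simp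
    with pos have "AE x in M. x \<notin> A"
      by eventually_elim (auto simp: indicator_def)
    then show False
      using AE_iff_measurable[of A M "\<lambda>x. x \<notin> A"] A assms(3) sets.sets_into_space[OF A]
      by (auto simp: Collect_conj_eq Int_absorb1 Int_absorb2)
  qed
  then show ?thesis
    using integral_nonneg_AE[OF nn] unfolding set_lebesgue_integral_def by linarith
qed

lemma set_integral_normal_law:
  assumes "A \<in> sets borel" and [measurable]: "f \<in> borel_measurable borel"
  shows "(\<integral>x\<in>A. f x \<partial>normal_law \<sigma> m) = (\<integral>x\<in>A. normal_density m \<sigma> x * f x \<partial>lborel)"
proof -
  note [measurable] = assms(1)
  have "(\<integral>x\<in>A. f x \<partial>normal_law \<sigma> m) = (\<integral>x. normal_density m \<sigma> x *\<^sub>R (indicator A x *\<^sub>R f x) \<partial>lborel)"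
    unfolding set_lebesgue_integral_def by (rule integral_density) simp_all
  then show ?thesis
    by (simp add: set_lebesgue_integral_def mult.left_commute)
qed

lemma measure_normal_law:
  assumes "0 < \<sigma>" and "A \<in> sets borel"
  shows "measure (normal_law \<sigma> m) A = (\<integral>x\<in>A. normal_density m \<sigma> x \<partial>lborel)"
proof -
  interpret prob_space "normal_law \<sigma> m"
    using assms(1) by (rule prob_space_normal_density)
  have "measure (normal_law \<sigma> m) A = (\<integral>x\<in>A. 1 \<partial>normal_law \<sigma> m)"
    using assms by (simp add: set_lebesgue_integral_def)
  then show ?thesis
    using assms by (simp add: set_integral_normal_law)
qed

text \<open>Bias-variance decomposition: \<open>p\<close> is the mass of \<open>A\<close> under the
  normal law and \<open>v\<close> the integral over \<open>A\<close> of the squared deviation from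
  the conditional mean. The cross term vanishes because deviations from the conditional mean
  integrate to zero over \<open>A\<close>.\<close>

lemma set_integral_normal_density_square:
  assumes s: "0 < \<sigma>" and A: "A \<in> sets borel" and pos: "emeasure lborel A > 0"
  obtains p v where "p > 0" "v > 0"
    "\<And>e w. (\<integral>x\<in>A. normal_density m \<sigma> x * (e + w * (x - m))\<^sup>2 \<partial>lborel)
       = p * (e + w * (cond_mean (normal_law \<sigma> m) A - m))\<^sup>2 + v * w\<^sup>2"
proof -
  let ?\<phi> = "normal_density m \<sigma>" and ?k = "cond_mean (normal_law \<sigma> m) A"
  define p where "p = (\<integral>x\<in>A. ?\<phi> x \<partial>lborel)"
  define v where "v = (\<integral>x\<in>A. ?\<phi> x * (x - ?k)\<^sup>2 \<partial>lborel)"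
  have \<phi>_pos: "?\<phi> x > 0" for x
    by (rule normal_density_pos[OF s])
  have int0: "set_integrable lborel A ?\<phi>"
    using set_integrable_normal_density_square[OF s A, of m 1 0] by simp
  have int1: "set_integrable lborel A (\<lambda>x. ?\<phi> x * x)"
  proof -
    have "integrable lborel (\<lambda>x. ?\<phi> x * (x - m) + m * ?\<phi> x)"
      using s normal_density_central_moments[of \<sigma> m]
      by (intro Bochner_Integration.integrable_add integrable_mult_right)
        (simp_all add: integrable_normal_density)
    then have "integrable lborel (\<lambda>x. ?\<phi> x * x)"
      by (simp add: algebra_simps)
    then show ?thesis
      unfolding set_integrable_def using A by (intro integrable_mult_indicator) simp_all
  qed
  have int2: "set_integrable lborel A (\<lambda>x. ?\<phi> x * (x - ?k)\<^sup>2)"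
    using set_integrable_normal_density_square[OF s A, of m "m - ?k" 1] by simp
  have "p > 0"
    unfolding p_def using A pos \<phi>_pos int0 by (intro set_integral_pos) simp_all
  have "v > 0"
    unfolding v_def
  proof (rule set_integral_pos[OF int2])
    \<comment> \<open>The integrand vanishes only at the conditional mean, a single point and hence
      null.\<close>
    show "AE x in lborel. x \<in> A \<longrightarrow> 0 < ?\<phi> x * (x - ?k)\<^sup>2"
      using AE_lborel_singleton[of ?k] by eventually_elim (use \<phi>_pos in simp)
  qed (use A pos in simp_all)
  have mean: "(\<integral>x\<in>A. ?\<phi> x * x \<partial>lborel) = ?k * p"
    using \<open>p > 0\<close> by (simp add: cond_mean_def set_integral_normal_law[OF A] measure_normal_law[OF s A] p_def)
  have "(\<integral>x\<in>A. ?\<phi> x * (e + w * (x - m))\<^sup>2 \<partial>lborel) = p * (e + w * (?k - m))\<^sup>2 + v * w\<^sup>2" for e w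
  proof -
    let ?f = "e + w * (?k - m)"
    \<comment> \<open>With \<open>?f\<close> the value of the affine function at \<open>?k\<close>,
      this expands the square of \<open>?f + w * (x - ?k)\<close>; the terms linear in
      \<open>x - ?k\<close> cancel upon integration by \<open>mean\<close>.\<close>
    have eq: "?\<phi> x * (e + w * (x - m))\<^sup>2
        = ((?f\<^sup>2 - 2 * ?f * w * ?k) * ?\<phi> x + 2 * ?f * w * (?\<phi> x * x)) + w\<^sup>2 * (?\<phi> x * (x - ?k)\<^sup>2)" for x
      by (simp add: algebra_simps power2_eq_square)
    have "(\<integral>x\<in>A. ?\<phi> x * (e + w * (x - m))\<^sup>2 \<partial>lborel)
        = ((?f\<^sup>2 - 2 * ?f * w * ?k) * p + 2 * ?f * w * (?k * p)) + w\<^sup>2 * v"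
      unfolding eq using int0 int1 int2
      by (subst set_integral_add; (intro set_integral_add set_integrable_mult_right)?)
        (simp_all add: mean p_def[symmetric] v_def[symmetric])
    then show ?thesis
      by (simp add: algebra_simps)
  qed
  with \<open>p > 0\<close> \<open>v > 0\<close> show ?thesis
    by (rule that)
qed

section \<open>Minimization of the divergence\<close>

lemma pseudo_true_iff:
  assumes s: "0 < \<sigma>" and le: "\<gamma>l \<le> \<gamma>h" and S: "S \<in> borel \<rightarrow>\<^sub>M count_space UNIV"
    and C: "emeasure lborel (S -` {Continue}) > 0"
  shows "pseudo_true \<sigma> a1 a2 r \<gamma>l \<gamma>h S (m1, m2, g) \<longleftrightarrow> m1 = a1 \<and> g = nearest \<gamma>l \<gamma>h r \<and>
    m2 = a2 + (r - nearest \<gamma>l \<gamma>h r) * (a1 - cond_mean (normal_law \<sigma> a1) (S -` {Continue}))"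
    (is "?pt m1 m2 g \<longleftrightarrow> _")
proof -
  let ?n = "nearest \<gamma>l \<gamma>h r" and ?k = "cond_mean (normal_law \<sigma> a1) (S -` {Continue}) - a1"
  \<comment> \<open>\<open>?m2\<close> solves \<open>a2 - ?m2 + (?n - r) * ?k = 0\<close>, so it
    removes the middle square at \<open>m1 = a1\<close> and \<open>g = ?n\<close>.\<close>
  let ?m2 = "a2 + (?n - r) * ?k"
  have "S -` {Continue} \<in> sets borel"
    using measurable_sets[OF S, of "{Continue}"] by simp
  from set_integral_normal_density_square[OF s this C, of a1] obtain p v
    where p: "p > 0" and v: "v > 0" and sq:
      "\<And>e w. (\<integral>x\<in>S -` {Continue}. normal_density a1 \<sigma> x * (e + w * (x - a1))\<^sup>2 \<partial>lborel)
       = p * (e + w * ?k)\<^sup>2 + v * w\<^sup>2" by blast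
  \<comment> \<open>\<open>F\<close> is \<open>2 * \<sigma>\<^sup>2\<close> times the divergence,
    obtained from \<open>sq\<close> at \<open>e = a2 - m2 + g * (a1 - m1)\<close> and
    \<open>w = g - r\<close>.\<close>
  define F where "F = (\<lambda>m1 m2 g. (a1 - m1)\<^sup>2 + p * (a2 - m2 + g * (a1 - m1) + (g - r) * ?k)\<^sup>2 + v * (g - r)\<^sup>2)"
  have KL: "D_KL (\<H> (\<Psi> \<sigma> a1 a2 r) S) (\<H> (\<Psi> \<sigma> m1 m2 g) S) = F m1 m2 g / (2 * \<sigma>\<^sup>2)" for m1 m2 g
    unfolding D_KL_history_normal[OF s S] sq F_def by (simp add: add.assoc)
  have n: "?n \<in> {\<gamma>l..\<gamma>h}"
    using le by (auto simp: nearest_eq_clamp)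
  have near: "\<bar>?n - r\<bar> < \<bar>g - r\<bar>" if "g \<in> {\<gamma>l..\<gamma>h}" "g \<noteq> ?n" for g
    using that le by (auto simp: nearest_eq_clamp max_def min_def split: if_splits)
  \<comment> \<open>Each deviation is penalized by its own square: the last one if \<open>g\<close>
    differs from \<open>?n\<close>, the first if only \<open>g\<close> is right, and the middle one
    if only \<open>m2\<close> is off. Strictness gives uniqueness of the minimizer.\<close>
  have F_min: "F a1 ?m2 ?n < F m1 m2 g"
    if g: "g \<in> {\<gamma>l..\<gamma>h}" and ne: "(m1, m2, g) \<noteq> (a1, ?m2, ?n)" for m1 m2 g
  proof -
    have F0: "F a1 ?m2 ?n = v * (?n - r)\<^sup>2"
      by (simp add: F_def)
    have Fg: "F m1 m2 g = (a1 - m1)\<^sup>2 + p * (a2 - m2 + g * (a1 - m1) + (g - r) * ?k)\<^sup>2 + v * (g - r)\<^sup>2"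
      by (simp add: F_def)
    have F_ge: "(a1 - m1)\<^sup>2 \<ge> 0" "p * (a2 - m2 + g * (a1 - m1) + (g - r) * ?k)\<^sup>2 \<ge> 0"
      using p by simp_all
    show ?thesis
    proof (cases "g = ?n")
      case False
      then have "v * (?n - r)\<^sup>2 < v * (g - r)\<^sup>2"
        using power_strict_mono[OF near[OF g], of 2] v by simp
      then show ?thesis
        using F_ge unfolding F0 Fg by linarith
    next
      case True
      show ?thesis
      proof (cases "m1 = a1")
        case False
        then have "(a1 - m1)\<^sup>2 > 0" by simp
        then have "F m1 m2 g > v * (g - r)\<^sup>2"
          using F_ge unfolding Fg by linarith
        then show ?thesis
          using True F0 by simp
      next
        case m1: True
        with ne True have "a2 - m2 + (?n - r) * ?k \<noteq> 0" by auto
        then show ?thesis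
          using p m1 True unfolding F0 Fg by simp
      qed
    qed
  qed
  have "?pt m1 m2 g \<longleftrightarrow> g \<in> {\<gamma>l..\<gamma>h} \<and> (\<forall>m1' m2' g'. g' \<in> {\<gamma>l..\<gamma>h} \<longrightarrow> F m1 m2 g \<le> F m1' m2' g')"
    using s unfolding pseudo_true_def is_arg_min_linorder
    by (simp add: KL divide_le_cancel)
  also have "\<dots> \<longleftrightarrow> (m1, m2, g) = (a1, ?m2, ?n)"
  proof
    assume "g \<in> {\<gamma>l..\<gamma>h} \<and> (\<forall>m1' m2' g'. g' \<in> {\<gamma>l..\<gamma>h} \<longrightarrow> F m1 m2 g \<le> F m1' m2' g')"
    then show "(m1, m2, g) = (a1, ?m2, ?n)"
      using n F_min[of g m1 m2] by (meson not_le)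
  next
    assume eq: "(m1, m2, g) = (a1, ?m2, ?n)"
    have "F a1 ?m2 ?n \<le> F m1' m2' g'" if "g' \<in> {\<gamma>l..\<gamma>h}" for m1' m2' g'
      using F_min[OF that, of m1' m2'] by (cases "(m1', m2', g') = (a1, ?m2, ?n)") auto
    then show "g \<in> {\<gamma>l..\<gamma>h} \<and> (\<forall>m1' m2' g'. g' \<in> {\<gamma>l..\<gamma>h} \<longrightarrow> F m1 m2 g \<le> F m1' m2' g')"
      using n eq by auto
  qed
  also have "\<dots> \<longleftrightarrow> m1 = a1 \<and> g = ?n \<and> m2 = a2 + (r - ?n) * (- ?k)"
    by (auto simp: algebra_simps)
  finally show ?thesis
    by simp
qed

section \<open>Cutoff strategies\<close>

lemma cond_mean_normal_law_cong:
  assumes s: "0 < \<sigma>" and A: "A \<in> sets borel" and B: "B \<in> sets borel"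
    and eq: "\<And>x. x \<noteq> c \<Longrightarrow> x \<in> A \<longleftrightarrow> x \<in> B"
  shows "cond_mean (normal_law \<sigma> m) A = cond_mean (normal_law \<sigma> m) B"
proof -
  \<comment> \<open>The sets differ at most in the null point \<open>c\<close>; this serves both the
    numerator and the denominator of \<open>cond_mean\<close>.\<close>
  have "(\<integral>x\<in>A. f x \<partial>lborel) = (\<integral>x\<in>B. f x \<partial>lborel)"
    if [measurable]: "f \<in> borel_measurable borel" for f :: "real \<Rightarrow> real"
  proof (rule set_integral_cong_set)
    show "AE x in lborel. x \<in> B \<longleftrightarrow> x \<in> A"
      using AE_lborel_singleton[of c] by eventually_elim (use eq in simp)
  qed (use A B in \<open>auto simp: set_borel_measurable_def\<close>)
  then show ?thesis
    using A B by (simp add: cond_mean_def set_integral_normal_law measure_normal_law[OF s])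
qed

theorem proposition1:
  fixes \<sigma> \<mu>1b \<mu>2b r \<gamma>l \<gamma>h :: real and S :: "real \<Rightarrow> action"
  assumes "\<sigma> > 0"
    and "\<gamma>l \<le> \<gamma>h"
    and "r \<noteq> -1" "\<gamma>l \<noteq> -1" "\<gamma>h \<noteq> -1"
    and "S \<in> borel \<rightarrow>\<^sub>M count_space UNIV"
    and "emeasure lborel (S -` {Continue}) > 0"
  defines "\<gamma>n \<equiv> nearest \<gamma>l \<gamma>h r"
  shows "(\<exists>!\<theta>. pseudo_true \<sigma> \<mu>1b \<mu>2b r \<gamma>l \<gamma>h S \<theta>) \<and>
    (\<forall>\<mu>1s \<mu>2s \<gamma>s. pseudo_true \<sigma> \<mu>1b \<mu>2b r \<gamma>l \<gamma>h S (\<mu>1s, \<mu>2s, \<gamma>s) \<longrightarrow>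
       \<mu>1s = \<mu>1b \<and> \<gamma>s = \<gamma>n \<and>
       (\<forall>c::ereal. c \<noteq> -\<infinity> \<and> (\<forall>x. S x = Stop \<longleftrightarrow> ereal x \<ge> c) \<longrightarrow>
          \<mu>2s = \<mu>2b + (r - \<gamma>n) * (\<mu>1b - cond_mean (normal_law \<sigma> \<mu>1b) {x. ereal x \<le> c})) \<and>
       (\<forall>c::ereal. c \<noteq> \<infinity> \<and> (\<forall>x. S x = Stop \<longleftrightarrow> ereal x \<le> c) \<longrightarrow>
          \<mu>2s = \<mu>2b + (r - \<gamma>n) * (\<mu>1b - cond_mean (normal_law \<sigma> \<mu>1b) {x. ereal x \<ge> c})))"
proof -
  let ?C = "S -` {Continue}"
  note pt = pseudo_true_iff[OF assms(1,2,6,7), of \<mu>1b \<mu>2b r, folded \<gamma>n_def]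
  have C: "?C \<in> sets borel"
    using measurable_sets[OF assms(6), of "{Continue}"] by simp
  have C_iff: "x \<in> ?C \<longleftrightarrow> S x \<noteq> Stop" for x
    by (cases "S x") simp_all
  \<comment> \<open>For a finite cutoff the continuation region is the open half-line, whereas the
    formula conditions on the closed one.\<close>
  have upper: "cond_mean (normal_law \<sigma> \<mu>1b) ?C = cond_mean (normal_law \<sigma> \<mu>1b) {x. ereal x \<le> c}"
    if st: "\<forall>x. S x = Stop \<longleftrightarrow> ereal x \<ge> c" for c
  proof (rule cond_mean_normal_law_cong[OF assms(1) C])
    \<comment> \<open>For infinite \<open>c\<close> both sets agree everywhere, so excluding the
      default value 0 of \<open>real_of_ereal c\<close> does no harm.\<close>
    show "x \<in> ?C \<longleftrightarrow> x \<in> {x. ereal x \<le> c}" if "x \<noteq> real_of_ereal c" for x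
      using that unfolding C_iff st[rule_format] by (cases c) auto
  qed simp
  have lower: "cond_mean (normal_law \<sigma> \<mu>1b) ?C = cond_mean (normal_law \<sigma> \<mu>1b) {x. ereal x \<ge> c}"
    if st: "\<forall>x. S x = Stop \<longleftrightarrow> ereal x \<le> c" for c
  proof (rule cond_mean_normal_law_cong[OF assms(1) C])
    show "x \<in> ?C \<longleftrightarrow> x \<in> {x. ereal x \<ge> c}" if "x \<noteq> real_of_ereal c" for x
      using that unfolding C_iff st[rule_format] by (cases c) auto
  qed simp
  have "\<exists>!\<theta>. pseudo_true \<sigma> \<mu>1b \<mu>2b r \<gamma>l \<gamma>h S \<theta>"
    by (rule ex1I[of _ "(\<mu>1b, \<mu>2b + (r - \<gamma>n) * (\<mu>1b - cond_mean (normal_law \<sigma> \<mu>1b) ?C), \<gamma>n)"])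
      (auto simp: pt split_paired_all)
  then show ?thesis
    using upper lower by (auto simp: pt)
qed

end
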